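(* Let $A=A^T\in\mathbb C^{n\times n}$ and $B=B^*\in\mathbb C^{n\times n}$ satisfy $BA=A\overline B$, and suppose the Hermitian matrix $D=A\overline A-B^2$ is nondegenerate. Put $G=\begin{pmatrix}-iB&A\\ \overline A&i\overline B\end{pmatrix}$. Then for every integer $m\ge0$ $$G^{2m}=\begin{pmatrix}D^m&0\\0&\overline D^m\end{pmatrix},\qquad G^{2m+1}=G\begin{pmatrix}D^m&0\\0&\overline D^m\end{pmatrix}=\begin{pmatrix}D^m&0\\0&\overline D^m\end{pmatrix}G,$$ the matrix $G$ is invertible with $$G^{-1}=\begin{pmatrix}-iD^{-1}B&D^{-1}A\\ \overline D^{-1}\overline A&i\overline D^{-1}\overline B\end{pmatrix}=\begin{pmatrix}-iBD^{-1}&A\overline D^{-1}\\ \overline AD^{-1}&i\overline B\,\overline D^{-1}\end{pmatrix},$$ and for all $t\in\mathbb R$ $$e^{Gt}=G\begin{pmatrix}D^{-\frac12}\sinh(D^{\frac12}t)&0\\0&\overline D^{-\frac12}\sinh(\overline D^{\frac12}t)\end{pmatrix}+\begin{pmatrix}\cosh(D^{\frac12}t)&0\\0&\cosh(\overline D^{\frac12}t)\end{pmatrix}.$$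
   Context: A bar denotes entrywise complex conjugation, $T$ transpose, $*$ Hermitian conjugation. Functions of the Hermitian matrices $D$ and $\overline D$ are defined by the spectral expansion; $D^{1/2}$ may have imaginary eigenvalues, and $\cosh(D^{1/2}t)$, $D^{-1/2}\sinh(D^{1/2}t)$ do not depend on the choice of the square root. *)

theory Defs
  imports
    Complex_Main
    "Jordan_Normal_Form.Schur_Decomposition"
    "Jordan_Normal_Form.Gauss_Jordan_Elimination"
begin

abbreviation mat_cnj :: "complex mat \<Rightarrow> complex mat" where
  "mat_cnj A \<equiv> map_mat cnj A"

(* Only meaningful for invertible square matrices. *)
abbreviation mat_inv :: "complex mat \<Rightarrow> complex mat" where
  "mat_inv A \<equiv> the (mat_inverse A)"

(* The power series of the exponential, summed entrywise; it converges for every square matrix. *)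
definition mat_exp :: "complex mat \<Rightarrow> complex mat" where
  "mat_exp A = mat (dim_row A) (dim_row A)
     (\<lambda>(i, j). \<Sum>k. (A ^\<^sub>m k) $$ (i, j) / fact k)"

definition eigenspace :: "complex mat \<Rightarrow> complex \<Rightarrow> complex vec set" where
  "eigenspace D z = {v \<in> carrier_vec (dim_row D). D *\<^sub>v v = z \<cdot>\<^sub>v v}"

(* P is the orthogonal projection of C^n onto the set V: idempotent, Hermitian, with range V. *)
definition is_orth_projection :: "nat \<Rightarrow> complex vec set \<Rightarrow> complex mat \<Rightarrow> bool" where
  "is_orth_projection n V P \<longleftrightarrow>
     P \<in> carrier_mat n n \<and> P * P = P \<and> mat_adjoint P = P \<and>
     (\<lambda>v. P *\<^sub>v v) ` carrier_vec n = V"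

(* Exists and is unique, since an eigenspace is a subspace. *)
definition spectral_projection :: "complex mat \<Rightarrow> complex \<Rightarrow> complex mat" where
  "spectral_projection D z =
     (THE P. is_orth_projection (dim_row D) (eigenspace D z) P)"

(* Spectral expansion f(D) = sum over the distinct eigenvalues z of f(z) P_z, for Hermitian D.
   The eigenvalues are real, but f may take non-real values: this is how D^(1/2) gets imaginary
   eigenvalues. *)
definition mat_fun :: "(complex \<Rightarrow> complex) \<Rightarrow> complex mat \<Rightarrow> complex mat" where
  "mat_fun f D = mat (dim_row D) (dim_row D)
     (\<lambda>(i, j). \<Sum>z \<in> {z. eigenvalue D z}. f z * spectral_projection D z $$ (i, j))"

end

theory Submission
  imports Defs "Jordan_Normal_Form.Spectral_Radius"
begin

text \<open>The relation \<open>BA = A\<close>conj\<open>(B)\<close> makes the off-diagonal blocks of \<open>G\<^sup>2\<close> vanish, so \<open>G\<^sup>2\<close> is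
  block diagonal with blocks \<open>D\<close> and its conjugate. Powers and inverse of \<open>G\<close> follow at once, and the
  exponential series splits into an even part and \<open>G\<close> times an odd part, both power series in \<open>G\<^sup>2\<close>.
  In an eigenbasis of the Hermitian matrix \<open>D\<close> these are the scalar series of \<open>cosh\<close> and \<open>sinh\<close>.\<close>

section \<open>Entrywise conjugation and adjoints of complex matrices\<close>

lemma index_mult_mat_sum:
  assumes "A \<in> carrier_mat nr n" "B \<in> carrier_mat n nc" "i < nr" "j < nc"
  shows "(A * B) $$ (i, j) = (\<Sum>k<n. A $$ (i, k) * B $$ (k, j))"
  using assms by (auto simp: scalar_prod_def lessThan_atLeast0 intro!: sum.cong)

lemma mat_cnj_mult:
  assumes "A \<in> carrier_mat nr n" "B \<in> carrier_mat n nc"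
  shows "mat_cnj (A * B) = mat_cnj A * mat_cnj B"
proof (rule eq_matI)
  fix i j assume "i < dim_row (mat_cnj A * mat_cnj B)" "j < dim_col (mat_cnj A * mat_cnj B)"
  then have ij: "i < nr" "j < nc" using assms by auto
  have cnj: "mat_cnj A \<in> carrier_mat nr n" "mat_cnj B \<in> carrier_mat n nc" using assms by auto
  show "mat_cnj (A * B) $$ (i, j) = (mat_cnj A * mat_cnj B) $$ (i, j)"
    using ij assms
    by (auto simp: index_mult_mat_sum[OF assms ij] index_mult_mat_sum[OF cnj ij] simp del: index_mult_mat(1)
        intro!: sum.cong)
qed (use assms in auto)

lemma mat_cnj_one: "mat_cnj (1\<^sub>m n) = 1\<^sub>m n"
  by (rule eq_matI) auto

lemma mat_adjoint_eq: "mat_adjoint A = mat_cnj (transpose_mat A)"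
  by (rule eq_matI) (auto simp: mat_adjoint_def mat_of_rows_def)

lemma mat_adjoint_carrier: "A \<in> carrier_mat nr nc \<Longrightarrow> mat_adjoint A \<in> carrier_mat nc nr" for A :: "complex mat"
  by (simp add: mat_adjoint_eq)

lemma index_mat_adjoint:
  "i < dim_col A \<Longrightarrow> j < dim_row A \<Longrightarrow> mat_adjoint A $$ (i, j) = cnj (A $$ (j, i))" for A :: "complex mat"
  by (simp add: mat_adjoint_eq)

lemma mat_adjoint_mult:
  fixes A B :: "complex mat"
  assumes "A \<in> carrier_mat nr n" "B \<in> carrier_mat n nc"
  shows "mat_adjoint (A * B) = mat_adjoint B * mat_adjoint A"
  unfolding mat_adjoint_eq transpose_mult[OF assms]
  by (rule mat_cnj_mult) (use assms in auto)

lemma mat_adjoint_adjoint: "mat_adjoint (mat_adjoint A) = A" for A :: "complex mat"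
  by (rule eq_matI) (auto simp: mat_adjoint_eq)

lemma mat_adjoint_one: "mat_adjoint (1\<^sub>m n) = (1\<^sub>m n :: complex mat)"
  by (simp add: mat_adjoint_eq mat_cnj_one)

section \<open>Diagonalization of Hermitian matrices through the Jordan normal form\<close>

lemma jordan_matrix_bidiagonal:
  assumes "i < sum_list (map fst n_as)" "j < sum_list (map fst n_as)"
    and "jordan_matrix n_as $$ (i, j) \<noteq> 0"
  shows "i = j \<or> j = Suc i \<and> jordan_matrix n_as $$ (i, i) = jordan_matrix n_as $$ (j, j)"
  using assms
proof (induction n_as arbitrary: i j)
  case (Cons na n_as)
  obtain n a where na: "na = (n, a)" by force
  let ?s = "sum_list (map fst n_as)"
  show ?case
  \<comment> \<open>An index inside the leading block of size \<open>n\<close> puts a nonzero entry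
    inside that block, whose diagonal is constant. Otherwise both indices are shifted by
    \<open>n\<close> into the remaining blocks.\<close>
  proof (cases "i < n \<or> j < n")
    case True
    then show ?thesis
      using Cons.prems by (auto simp: na jordan_matrix_Cons split: if_splits)
  next
    case False
    then have "i - n < ?s" "j - n < ?s" "jordan_matrix n_as $$ (i - n, j - n) \<noteq> 0"
      using Cons.prems by (auto simp: na jordan_matrix_Cons split: if_splits)
    from Cons.IH[OF this] show ?thesis
      using False Cons.prems by (auto simp: na jordan_matrix_Cons)
  qed
qed simp

text \<open>With \<open>C = P\<^sup>* P\<close>, self-adjointness of \<open>D = P J P\<^sup>-\<^sup>1\<close> reads \<open>J\<^sup>* C = C J\<close>. Since the diagonal of
  \<open>C\<close> is positive, comparing entries rules out nonzero superdiagonal entries of the Jordan matrix \<open>J\<close>,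
  and then shows that \<open>C\<close> only links equal eigenvalues.\<close>
lemma hermitian_diagonalization:
  fixes D :: "complex mat"
  assumes D: "D \<in> carrier_mat n n" and herm: "mat_adjoint D = D"
  obtains P Q d where "P \<in> carrier_mat n n" "Q \<in> carrier_mat n n" "P * Q = 1\<^sub>m n" "Q * P = 1\<^sub>m n"
    "D = P * mat_diag n d * Q"
    "\<And>i j. i < n \<Longrightarrow> j < n \<Longrightarrow> (mat_adjoint P * P) $$ (i, j) \<noteq> 0 \<Longrightarrow> d i = d j"
proof -
  note assoc = assoc_mult_mat[of _ n n _ n _ n]
  obtain es where "char_poly D = (\<Prod>a\<leftarrow>es. [:- a, 1:])"
    using char_poly_factorized[OF D] by blast
  from jordan_nf_exists[OF D this] obtain n_as where "jordan_nf D n_as" by blast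
  then obtain P Q where wit: "similar_mat_wit D (jordan_matrix n_as) P Q"
    unfolding jordan_nf_def similar_mat_def by blast
  define J where "J = jordan_matrix n_as"
  from similar_mat_witD2[OF D wit]
  have PQ: "P * Q = 1\<^sub>m n" and QP: "Q * P = 1\<^sub>m n" and DPJ: "D = P * J * Q"
    and J: "J \<in> carrier_mat n n" and P: "P \<in> carrier_mat n n" and Q: "Q \<in> carrier_mat n n"
    by (auto simp: J_def)
  have n: "n = sum_list (map fst n_as)"
    using J unfolding J_def carrier_mat_def by auto
  have bid: "i = j \<or> j = Suc i \<and> J $$ (i, i) = J $$ (j, j)"
    if "i < n" "j < n" "J $$ (i, j) \<noteq> 0" for i j
    using jordan_matrix_bidiagonal[of i n_as j] that by (simp add: J_def n)
  define P' where "P' = mat_adjoint P"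
  define J' where "J' = mat_adjoint J"
  have P': "P' \<in> carrier_mat n n" and J': "J' \<in> carrier_mat n n"
    using P J by (auto simp: P'_def J'_def intro: mat_adjoint_carrier)
  define C where "C = P' * P"
  have C: "C \<in> carrier_mat n n" using P P' by (simp add: C_def)
  have CJ: "C * J = P' * D * P"
    using P Q J P' D QP by (simp add: C_def DPJ assoc)
  \<comment> \<open>Both \<open>C * J\<close>, being a congruence of \<open>D\<close>, and the Gram
    matrix \<open>C\<close> are self-adjoint. Taking the adjoint of \<open>C * J\<close> therefore
    gives the relation \<open>comm\<close>.\<close>
  have "mat_adjoint (P' * D * P) = P' * D * P"
    using P P' D herm
    by (simp add: mat_adjoint_mult[of _ n n _ n] assoc mat_adjoint_adjoint P'_def)
  moreover have "mat_adjoint C = C"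
    using P P' by (simp add: C_def mat_adjoint_mult[of _ n n _ n] mat_adjoint_adjoint P'_def)
  ultimately have comm: "J' * C = C * J"
    using mat_adjoint_mult[OF C J] by (simp add: CJ J'_def)
  \<comment> \<open>This entry is the squared norm of column \<open>i\<close> of \<open>P\<close>. A
    zero column would contradict \<open>Q * P = 1\<close>.\<close>
  have Cii: "C $$ (i, i) \<noteq> 0" if i: "i < n" for i
  proof
    have "C $$ (i, i) = (\<Sum>k<n. cnj (P $$ (k, i)) * P $$ (k, i))"
      unfolding C_def index_mult_mat_sum[OF P' P i i]
      using P i by (intro sum.cong) (auto simp: P'_def index_mat_adjoint)
    also have "\<dots> = of_real (\<Sum>k<n. (cmod (P $$ (k, i)))\<^sup>2)"
      by (simp add: complex_norm_square mult.commute del: of_real_power)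
    finally have eq: "C $$ (i, i) = of_real (\<Sum>k<n. (cmod (P $$ (k, i)))\<^sup>2)" .
    assume "C $$ (i, i) = 0"
    then have "(\<Sum>k<n. (cmod (P $$ (k, i)))\<^sup>2) = 0" unfolding eq of_real_eq_0_iff .
    then have "P $$ (k, i) = 0" if "k < n" for k
      using that by (subst (asm) sum_nonneg_eq_0_iff) auto
    then have "(Q * P) $$ (i, i) = 0"
      unfolding index_mult_mat_sum[OF Q P i i] by simp
    then show False using QP i by simp
  qed
  have super: "J $$ (i, Suc i) = 0" if "Suc i < n" for i
    using that
  proof (induction i rule: less_induct)
    case (less i)
    then have i: "i < n" and si: "Suc i < n" by auto
    \<comment> \<open>The induction hypothesis removes the superdiagonal entry of column
      \<open>i\<close>, so only the diagonal entry is left. Row \<open>i\<close> of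
      \<open>J'\<close> is then diagonal as well.\<close>
    have coli: "J $$ (k, i) = 0" if "k < n" "k \<noteq> i" for k
      using bid[OF that(1) i] that(2) less.IH[of k] i by auto
    have cols: "J $$ (k, Suc i) = 0" if "k < n" "k \<noteq> i" "k \<noteq> Suc i" for k
      using bid[OF that(1) si] that(2,3) by auto
    have row: "(J' * C) $$ (i, j) = cnj (J $$ (i, i)) * C $$ (i, j)" if j: "j < n" for j
    proof -
      have "(J' * C) $$ (i, j) = (\<Sum>k<n. if k = i then cnj (J $$ (i, i)) * C $$ (i, j) else 0)"
        unfolding index_mult_mat_sum[OF J' C i j]
        using J i coli by (intro sum.cong) (auto simp: J'_def index_mat_adjoint)
      then show ?thesis using i by simp
    qed
    have "(C * J) $$ (i, i) = (\<Sum>k<n. if k = i then C $$ (i, i) * J $$ (i, i) else 0)"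
      unfolding index_mult_mat_sum[OF C J i i]
      using coli by (intro sum.cong) auto
    with row[OF i] Cii[OF i] i have real: "cnj (J $$ (i, i)) = J $$ (i, i)"
      by (simp add: comm)
    show "J $$ (i, Suc i) = 0"
    proof (rule ccontr)
      assume nz: "J $$ (i, Suc i) \<noteq> 0"
      \<comment> \<open>A nonzero superdiagonal entry forces equal diagonal neighbours. As
        \<open>J $$ (i, i)\<close> is real, the terms with \<open>C $$ (i, Suc i)\<close> on the two
        sides of \<open>comm\<close> cancel, leaving
        \<open>C $$ (i, i) * J $$ (i, Suc i) = 0\<close>.\<close>
      have "(C * J) $$ (i, Suc i) = (\<Sum>k<n. (if k = i then C $$ (i, i) * J $$ (i, Suc i) else 0)
              + (if k = Suc i then C $$ (i, Suc i) * J $$ (Suc i, Suc i) else 0))"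
        unfolding index_mult_mat_sum[OF C J i si]
        using cols by (intro sum.cong) auto
      also have "\<dots> = C $$ (i, i) * J $$ (i, Suc i) + C $$ (i, Suc i) * J $$ (Suc i, Suc i)"
        using i si by (simp add: sum.distrib)
      finally have "C $$ (i, i) * J $$ (i, Suc i) = 0"
        using row[OF si] real bid[OF i si nz] by (simp add: comm)
      with Cii[OF i] nz show False by simp
    qed
  qed
  define d where "d = (\<lambda>i. J $$ (i, i))"
  have Jd: "J = mat_diag n d"
  proof (rule eq_matI)
    fix i j assume "i < dim_row (mat_diag n d)" "j < dim_col (mat_diag n d)"
    then have ij: "i < n" "j < n" by (auto simp: mat_diag_def)
    then show "J $$ (i, j) = mat_diag n d $$ (i, j)"
      using bid[OF ij] super[of i] by (auto simp: mat_diag_def d_def)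
  qed (use J in \<open>auto simp: mat_diag_def\<close>)
  have J'd: "J' = mat_diag n (\<lambda>i. cnj (d i))"
    unfolding J'_def mat_adjoint_eq Jd by (rule eq_matI) (auto simp: mat_diag_def)
  have CJd: "cnj (d i) * C $$ (i, j) = C $$ (i, j) * d j" if "i < n" "j < n" for i j
    using arg_cong[OF comm, of "\<lambda>M. M $$ (i, j)"] that
    unfolding J'd Jd mat_diag_mult_left[OF C] mat_diag_mult_right[OF C] by simp
  show ?thesis
  proof (rule that[OF P Q PQ QP])
    show "D = P * mat_diag n d * Q" using DPJ Jd by simp
    fix i j assume ij: "i < n" "j < n" and nz: "(mat_adjoint P * P) $$ (i, j) \<noteq> 0"
    have "cnj (d i) = d i" using CJd[of i i] Cii[of i] ij by simp
    then show "d i = d j"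
      using CJd[of i j] ij nz by (simp add: C_def P'_def)
  qed
qed

section \<open>Spectral projections and functions of a Hermitian matrix in an eigenbasis\<close>

lemma is_orth_projection_unique:
  assumes "is_orth_projection n V P" "is_orth_projection n V Q"
  shows "P = Q"
proof -
  \<comment> \<open>Each column of \<open>S\<close> lies in the common range \<open>V\<close>, where
    the idempotent \<open>R\<close> acts as the identity. Taking adjoints of
    \<open>Q * P = P\<close> then exchanges the factors, so that
    \<open>P = P * Q = Q\<close>.\<close>
  have absorb: "R * S = S" if "is_orth_projection n V R" "is_orth_projection n V S" for R S
  proof -
    have R: "R \<in> carrier_mat n n" "R * R = R" "(\<lambda>v. R *\<^sub>v v) ` carrier_vec n = V"
      and S: "S \<in> carrier_mat n n" "(\<lambda>v. S *\<^sub>v v) ` carrier_vec n = V"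
      using that by (auto simp: is_orth_projection_def)
    show "R * S = S"
    proof (rule mat_col_eqI)
      fix j assume "j < dim_col S"
      then have j: "j < n" using S by simp
      have "S *\<^sub>v unit_vec n j \<in> V" using S(2) by auto
      then obtain u where u: "u \<in> carrier_vec n" "S *\<^sub>v unit_vec n j = R *\<^sub>v u"
        using R(3) by (metis imageE)
      have Sj: "S *\<^sub>v unit_vec n j = col S j"
        using col_mult2[OF S(1) one_carrier_mat j] S(1) j by simp
      have "R *\<^sub>v col S j = R *\<^sub>v (R *\<^sub>v u)" using u Sj by simp
      also have "\<dots> = (R * R) *\<^sub>v u" using R(1) u(1) by simp
      also have "\<dots> = col S j" using R(2) u Sj by simp
      finally show "col (R * S) j = col S j" unfolding col_mult2[OF R(1) S(1) j] .
    qed (use R S in auto)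
  qed
  have PQ: "P \<in> carrier_mat n n" "Q \<in> carrier_mat n n" "mat_adjoint P = P" "mat_adjoint Q = Q"
    using assms by (auto simp: is_orth_projection_def)
  have "P = mat_adjoint (Q * P)" using absorb[OF assms(2,1)] PQ by simp
  also have "\<dots> = P * Q" using PQ by (simp add: mat_adjoint_mult[of _ n n _ n])
  also have "\<dots> = Q" using absorb[OF assms] .
  finally show ?thesis .
qed

lemma mat_diag_mult_vec:
  assumes "w \<in> carrier_vec n"
  shows "mat_diag n f *\<^sub>v w = vec n (\<lambda>i. f i * w $ i)"
proof (rule eq_vecI)
  fix i assume "i < dim_vec (vec n (\<lambda>i. f i * w $ i))"
  then have i: "i < n" by simp
  have "(mat_diag n f *\<^sub>v w) $ i = (\<Sum>j = 0..<n. (if i = j then f j else 0) * w $ j)"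
    using i assms by (simp add: mat_diag_def scalar_prod_def)
  also have "\<dots> = f i * w $ i"
    using i by (subst sum.remove[of _ i]) auto
  finally show "(mat_diag n f *\<^sub>v w) $ i = vec n (\<lambda>i. f i * w $ i) $ i" using i by simp
qed (simp add: mat_diag_def)

lemma mat_diag_pow: "mat_diag n f ^\<^sub>m k = mat_diag n (\<lambda>i. f i ^ k)" for f :: "nat \<Rightarrow> 'a :: comm_semiring_1"
proof (induction k)
  case 0
  show ?case by (simp add: mat_diag_def one_mat_def cong: if_cong)
next
  case (Suc k)
  then show ?case by (simp add: mult.commute)
qed

lemma index_conj_mat_diag:
  assumes "P \<in> carrier_mat n n" "Q \<in> carrier_mat n n" "i < n" "j < n"
  shows "(P * mat_diag n f * Q) $$ (i, j) = (\<Sum>p<n. P $$ (i, p) * f p * Q $$ (p, j))"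
  using assms unfolding mat_diag_mult_right[OF assms(1)]
  by (subst index_mult_mat_sum[of _ n n _ n]) auto

text \<open>The eigenbasis is not normalized: \<open>P\<close> may fail to be unitary. Instead,
  \<open>gram\<close> records that eigenvectors to different eigenvalues are orthogonal, which
  suffices to make the spectral projections Hermitian.\<close>

locale hermitian_eigenbasis =
  fixes n :: nat and D P Q :: "complex mat" and d :: "nat \<Rightarrow> complex"
  assumes P: "P \<in> carrier_mat n n" and Q: "Q \<in> carrier_mat n n"
    and PQ: "P * Q = 1\<^sub>m n" and QP: "Q * P = 1\<^sub>m n"
    and D_eq: "D = P * mat_diag n d * Q"
    and gram: "\<And>i j. i < n \<Longrightarrow> j < n \<Longrightarrow> (mat_adjoint P * P) $$ (i, j) \<noteq> 0 \<Longrightarrow> d i = d j"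
begin

lemmas assoc = assoc_mult_mat[of _ n n _ n _ n] mult_carrier_mat[of _ n n _ n]

lemma D: "D \<in> carrier_mat n n"
  using P Q by (simp add: D_eq assoc)

text \<open>A rewrite rule for right-associated products, in which \<open>Q * P\<close> no longer
  occurs as a subterm.\<close>

lemma QPX: "X \<in> carrier_mat n n \<Longrightarrow> Q * (P * X) = X"
  using assoc_mult_mat[OF Q P, of X] by (simp add: QP)

text \<open>In eigenbasis coordinates the projection keeps exactly the coordinates with eigenvalue
  \<open>z\<close>. The resulting matrix meets the defining conditions, and their uniqueness
  resolves the \<open>THE\<close>.\<close>

lemma spectral_projection_eq:
  "spectral_projection D z = P * mat_diag n (\<lambda>i. if d i = z then 1 else 0) * Q"
proof -
  define E where "E = mat_diag n (\<lambda>i. if d i = z then 1 else 0 :: complex)"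
  have E: "E \<in> carrier_mat n n" by (simp add: E_def)
  define F where "F = P * E * Q"
  have F: "F \<in> carrier_mat n n" using P Q E by (simp add: F_def assoc)
  define P' where "P' = mat_adjoint P"
  define Q' where "Q' = mat_adjoint Q"
  have P': "P' \<in> carrier_mat n n" and Q': "Q' \<in> carrier_mat n n"
    using P Q by (auto simp: P'_def Q'_def intro: mat_adjoint_carrier)
  have Q'P': "Q' * P' = 1\<^sub>m n"
    using P Q PQ mat_adjoint_mult[of P n n Q n] by (simp add: P'_def Q'_def mat_adjoint_one)
  have EE: "E * E = E"
    unfolding E_def mat_diag_diag by (rule arg_cong[of _ _ "mat_diag n"]) auto
  have Q'P'X: "Q' * (P' * X) = X" if "X \<in> carrier_mat n n" for X
    using assoc_mult_mat[OF Q' P' that] that by (simp add: Q'P')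
  have idem: "F * F = F"
  proof -
    have "F * F = P * (E * E) * Q"
      using P Q E by (simp add: F_def assoc QPX)
    then show ?thesis by (simp add: EE F_def)
  qed
  \<comment> \<open>By \<open>gram\<close>, \<open>P' * P\<close> is zero between different
    eigenvalues, while \<open>E\<close> is constant on each group of equal ones.\<close>
  have "(P' * P) * E = E * (P' * P)"
  proof -
    have C: "P' * P \<in> carrier_mat n n" using P P' by simp
    have "(P' * P) $$ (i, j) = 0" if "i < n" "j < n" "d i \<noteq> d j" for i j
      using gram that by (auto simp: P'_def)
    then show ?thesis
      unfolding E_def mat_diag_mult_left[OF C] mat_diag_mult_right[OF C]
      by (intro eq_matI) (auto simp del: index_mult_mat(1))
  qed
  \<comment> \<open>Cancelling \<open>Q' * P'\<close> on the left and \<open>P * Q\<close> on the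
    right leaves \<open>F\<close> on one side and its adjoint on the other.\<close>
  then have "Q' * ((P' * P) * E) * Q = Q' * (E * (P' * P)) * Q" by simp
  then have conj: "P * E * Q = Q' * E * P'"
    using P Q P' Q' E PQ by (simp add: assoc Q'P'X)
  have "mat_adjoint E = E"
    by (rule eq_matI) (auto simp: mat_adjoint_eq E_def mat_diag_def)
  then have herm: "mat_adjoint F = F"
    using P Q E conj by (simp add: F_def mat_adjoint_mult[of _ n n _ n] P'_def Q'_def assoc
        mat_adjoint_carrier mat_adjoint_adjoint)
  have LE: "mat_diag n d * E = z \<cdot>\<^sub>m E"
    unfolding E_def mat_diag_diag by (rule eq_matI) (auto simp: mat_diag_def)
  have DF: "D * F = z \<cdot>\<^sub>m F"
  proof -
    have "D * F = P * (mat_diag n d * E) * Q"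
      using P Q E by (simp add: F_def D_eq assoc QPX)
    also have "\<dots> = z \<cdot>\<^sub>m F"
      unfolding LE using P Q E by (simp add: F_def mult_smult_distrib[of _ n n _ n] mult_smult_assoc_mat[of _ n n _ n])
    finally show ?thesis .
  qed
  have range: "(\<lambda>v. F *\<^sub>v v) ` carrier_vec n = eigenspace D z"
  proof (intro equalityI subsetI)
    fix u assume "u \<in> (\<lambda>v. F *\<^sub>v v) ` carrier_vec n"
    then obtain v where v: "v \<in> carrier_vec n" "u = F *\<^sub>v v" by auto
    have "D *\<^sub>v u = (D * F) *\<^sub>v v" using D F v by simp
    also have "\<dots> = z \<cdot>\<^sub>v u" unfolding DF using F v by (intro eq_vecI) auto
    finally show "u \<in> eigenspace D z" using D F v by (simp add: eigenspace_def)
  next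
    fix v assume "v \<in> eigenspace D z"
    then have v: "v \<in> carrier_vec n" and Dv: "D *\<^sub>v v = z \<cdot>\<^sub>v v"
      using D by (auto simp: eigenspace_def)
    \<comment> \<open>The eigenbasis coordinates of \<open>v\<close>. The eigenvalue equation kills
      those with \<open>d i \<noteq> z\<close>, so \<open>E\<close> fixes \<open>w\<close> and hence
      \<open>F\<close> fixes \<open>v\<close>.\<close>
    define w where "w = Q *\<^sub>v v"
    have w: "w \<in> carrier_vec n" using Q v by (simp add: w_def)
    have "mat_diag n d *\<^sub>v w = (Q * D) *\<^sub>v v"
      using P Q v by (simp add: D_eq assoc QPX w_def assoc_mult_mat_vec[of _ n n _ n])
    also have "\<dots> = z \<cdot>\<^sub>v w" using Q D v Dv by (simp add: mult_mat_vec w_def)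
    finally have Lw: "mat_diag n d *\<^sub>v w = z \<cdot>\<^sub>v w" .
    have nz: "w $ i = 0" if "i < n" "d i \<noteq> z" for i
      using arg_cong[OF Lw, of "\<lambda>x. x $ i"] that w by (simp add: mat_diag_mult_vec)
    have "E *\<^sub>v w = w"
      unfolding E_def mat_diag_mult_vec[OF w] using w nz by (intro eq_vecI) auto
    then have "F *\<^sub>v v = P *\<^sub>v w"
      using P Q E v by (simp add: F_def w_def assoc_mult_mat_vec[of _ n n _ n])
    also have "\<dots> = v"
      using P Q v PQ assoc_mult_mat_vec[OF P Q v] by (simp add: w_def)
    finally show "v \<in> (\<lambda>v. F *\<^sub>v v) ` carrier_vec n" using v by (metis imageI)
  qed
  have "is_orth_projection (dim_row D) (eigenspace D z) F"
    using D F idem herm range by (simp add: is_orth_projection_def)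
  then have "spectral_projection D z = F"
    unfolding spectral_projection_def by (blast intro: the_equality is_orth_projection_unique)
  then show ?thesis by (simp add: F_def E_def)
qed

lemma finite_eigenvalues: "finite {z. eigenvalue D z}"
  using D by (simp add: card_finite_spectrum spectrum_def[symmetric])

text \<open>Column \<open>p\<close> of \<open>P\<close> is an eigenvector, nonzero because
  \<open>Q * P = 1\<close>. This places \<open>d p\<close> in the index set of the sum that defines
  \<open>mat_fun\<close>.\<close>

lemma eigenvalue_d:
  assumes "p < n"
  shows "eigenvalue D (d p)"
proof -
  have "D * P = P * mat_diag n d" using P Q QP using right_mult_one_mat[of "mat_diag n d" n n]
    by (simp add: D_eq assoc)
  then have "D *\<^sub>v col P p = col (P * mat_diag n d) p"
    using D P assms by (metis col_mult2)
  also have "\<dots> = d p \<cdot>\<^sub>v col P p"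
    unfolding mat_diag_mult_right[OF P] using P assms by (intro eq_vecI) auto
  finally have ev: "D *\<^sub>v col P p = d p \<cdot>\<^sub>v col P p" .
  have "col P p \<noteq> 0\<^sub>v n"
  proof
    assume "col P p = 0\<^sub>v n"
    then have "(Q * P) $$ (p, p) = 0" using P Q assms by simp
    then show False using QP assms by simp
  qed
  then show ?thesis
    using ev D P assms by (auto simp: eigenvalue_def eigenvector_def intro!: exI[of _ "col P p"])
qed

text \<open>The definition sums over distinct eigenvalues, whereas \<open>d\<close> lists them with
  multiplicity. After exchanging the sums, each \<open>p\<close> keeps the single term
  \<open>z = d p\<close>.\<close>

lemma mat_fun_eq: "mat_fun f D = P * mat_diag n (\<lambda>i. f (d i)) * Q"
proof (rule eq_matI)
  fix i j assume "i < dim_row (P * mat_diag n (\<lambda>i. f (d i)) * Q)" "j < dim_col (P * mat_diag n (\<lambda>i. f (d i)) * Q)"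
  then have ij: "i < n" "j < n" using P Q by auto
  let ?S = "{z. eigenvalue D z}"
  have "mat_fun f D $$ (i, j)
      = (\<Sum>z\<in>?S. f z * (\<Sum>p<n. P $$ (i, p) * (if d p = z then 1 else 0) * Q $$ (p, j)))"
    using D ij by (simp add: mat_fun_def spectral_projection_eq index_conj_mat_diag[OF P Q] del: index_mult_mat(1))
  also have "\<dots> = (\<Sum>p<n. \<Sum>z\<in>?S. if z = d p then P $$ (i, p) * f (d p) * Q $$ (p, j) else 0)"
    unfolding sum_distrib_left by (subst sum.swap) (auto intro!: sum.cong)
  also have "\<dots> = (\<Sum>p<n. P $$ (i, p) * f (d p) * Q $$ (p, j))"
    using eigenvalue_d by (intro sum.cong) (auto simp: finite_eigenvalues)
  finally show "mat_fun f D $$ (i, j) = (P * mat_diag n (\<lambda>i. f (d i)) * Q) $$ (i, j)"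
    using ij by (simp add: index_conj_mat_diag[OF P Q] del: index_mult_mat(1))
qed (use D P Q in \<open>auto simp: mat_fun_def\<close>)

lemma mat_fun_mult: "mat_fun f D * mat_fun g D = P * mat_diag n (\<lambda>i. f (d i) * g (d i)) * Q"
proof -
  have "mat_fun f D * mat_fun g D = P * (mat_diag n (\<lambda>i. f (d i)) * mat_diag n (\<lambda>i. g (d i))) * Q"
    using P Q by (simp add: mat_fun_eq assoc QPX del: mat_diag_diag)
  then show ?thesis by simp
qed

lemma index_pow:
  assumes "i < n" "j < n"
  shows "(D ^\<^sub>m m) $$ (i, j) = (\<Sum>p<n. P $$ (i, p) * d p ^ m * Q $$ (p, j))"
proof -
  have "similar_mat_wit D (mat_diag n d) P Q"
    by (rule similar_mat_witI[OF PQ QP D_eq D _ P Q]) simp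
  from similar_mat_wit_pow_id[OF this] show ?thesis
    using assms by (simp add: mat_diag_pow index_conj_mat_diag[OF P Q] del: index_mult_mat(1))
qed

lemma d_nonzero:
  assumes "invertible_mat D" "p < n"
  shows "d p \<noteq> 0"
proof
  \<comment> \<open>Invertibility gives \<open>M\<close> without its dimensions; these are read off
    from the column counts of the two products.\<close>
  obtain M where "D * M = 1\<^sub>m n" "M * D = 1\<^sub>m (dim_row M)"
    using assms(1) D by (auto simp: invertible_mat_def inverts_mat_def)
  moreover from this have M: "M \<in> carrier_mat n n"
    using D by (metis carrier_matD(2) carrier_matI index_mult_mat(3) index_one_mat(3))
  ultimately have DM: "D * M = 1\<^sub>m n" by simp
  \<comment> \<open>The diagonal matrix inherits a right inverse from \<open>D\<close>, so none of
    its rows can be zero.\<close>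
  have "mat_diag n d * (Q * M * P) = Q * (D * M) * P"
    using P Q M by (simp add: D_eq assoc QPX)
  also have "\<dots> = 1\<^sub>m n" using Q DM QP by simp
  finally have "(mat_diag n d * (Q * M * P)) $$ (p, p) = 1" using assms by simp
  moreover assume "d p = 0"
  ultimately show False
    using P Q M assms(2) by (subst (asm) mat_diag_mult_left[of _ n n]) auto
qed

text \<open>Even powers of the root depend only on its square, so every pointwise choice of root
  yields the same power series in \<open>D\<close>.\<close>

lemma cosh_series:
  assumes r: "\<And>z. (r z)\<^sup>2 = z" and ij: "i < n" "j < n"
  shows "(\<lambda>k. if even k then t ^ k / fact k * (D ^\<^sub>m (k div 2)) $$ (i, j) else 0) sums
    mat_fun (\<lambda>z. cosh (r z * t)) D $$ (i, j)"
proof -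
  have "(\<lambda>k. \<Sum>p<n. P $$ (i, p) * (if even k then (r (d p) * t) ^ k /\<^sub>R fact k else 0) * Q $$ (p, j)) sums
      (\<Sum>p<n. P $$ (i, p) * cosh (r (d p) * t) * Q $$ (p, j))"
    by (intro sums_sum sums_mult sums_mult2 cosh_converges)
  moreover have "(\<Sum>p<n. P $$ (i, p) * (if even k then (r (d p) * t) ^ k /\<^sub>R fact k else 0) * Q $$ (p, j))
      = (if even k then t ^ k / fact k * (D ^\<^sub>m (k div 2)) $$ (i, j) else 0)" for k
  proof (cases "even k")
    case True
    then obtain m where k: "k = 2 * m" by auto
    have "(r (d p) * t) ^ k = d p ^ m * t ^ k" for p
      by (simp add: k power_mult_distrib power_mult r)
    then show ?thesis
      using True ij by (simp add: k index_pow sum_distrib_left scaleR_conv_of_real divide_inverse mult_ac)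
  qed simp
  ultimately show ?thesis
    using ij by (simp add: mat_fun_eq index_conj_mat_diag[OF P Q] del: index_mult_mat(1))
qed

text \<open>The factor \<open>inverse (r z)\<close> removes one root from each odd power, leaving
  powers of \<open>z\<close>. The cancellation is legitimate because an invertible \<open>D\<close>
  has no eigenvalue 0.\<close>

lemma sinh_series:
  assumes r: "\<And>z. (r z)\<^sup>2 = z" and inv: "invertible_mat D" and ij: "i < n" "j < n"
  shows "(\<lambda>k. if even k then 0 else t ^ k / fact k * (D ^\<^sub>m (k div 2)) $$ (i, j)) sums
    (mat_fun (\<lambda>z. inverse (r z)) D * mat_fun (\<lambda>z. sinh (r z * t)) D) $$ (i, j)"
proof -
  have "(\<lambda>k. \<Sum>p<n. P $$ (i, p) * (inverse (r (d p)) * (if even k then 0 else (r (d p) * t) ^ k /\<^sub>R fact k)) * Q $$ (p, j)) sums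
      (\<Sum>p<n. P $$ (i, p) * (inverse (r (d p)) * sinh (r (d p) * t)) * Q $$ (p, j))"
    by (intro sums_sum sums_mult sums_mult2 sinh_converges)
  moreover have "(\<Sum>p<n. P $$ (i, p) * (inverse (r (d p)) * (if even k then 0 else (r (d p) * t) ^ k /\<^sub>R fact k)) * Q $$ (p, j))
      = (if even k then 0 else t ^ k / fact k * (D ^\<^sub>m (k div 2)) $$ (i, j))" for k
  proof (cases "even k")
    case False
    then obtain m where k: "k = 2 * m + 1" by (auto elim: oddE)
    have "inverse (r (d p)) * ((r (d p) * t) ^ k /\<^sub>R fact k) = d p ^ m * (t ^ k / fact k)" if "p < n" for p
    proof -
      have "r (d p) \<noteq> 0" using r[of "d p"] d_nonzero[OF inv that] by auto
      moreover have "(r (d p) * t) ^ k = r (d p) * (d p ^ m * t ^ k)"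
        by (simp add: k power_mult_distrib power_mult r)
      ultimately show ?thesis by (simp add: scaleR_conv_of_real divide_inverse)
    qed
    then show ?thesis
      using False ij by (simp add: k index_pow sum_distrib_left) (auto intro!: sum.cong simp: mult_ac)
  qed simp
  ultimately show ?thesis
    using ij by (simp add: mat_fun_mult index_conj_mat_diag[OF P Q] del: index_mult_mat(1))
qed

end

lemma hermitian_eigenbasis_exists:
  assumes "D \<in> carrier_mat n n" "mat_adjoint D = D"
  obtains P Q d where "hermitian_eigenbasis n D P Q d"
proof -
  obtain P Q d where "P \<in> carrier_mat n n" "Q \<in> carrier_mat n n" "P * Q = 1\<^sub>m n" "Q * P = 1\<^sub>m n"
    "D = P * mat_diag n d * Q"
    "\<And>i j. i < n \<Longrightarrow> j < n \<Longrightarrow> (mat_adjoint P * P) $$ (i, j) \<noteq> 0 \<Longrightarrow> d i = d j"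
    using hermitian_diagonalization[OF assms] by blast
  then show ?thesis by (intro that[of P Q d] hermitian_eigenbasis.intro)
qed

section \<open>Inverses, and powers of a matrix with a given square\<close>

lemma mat_inv_eqI:
  assumes M: "M \<in> carrier_mat n n" and X: "X \<in> carrier_mat n n" and MX: "M * X = 1\<^sub>m n"
  shows "invertible_mat M" "mat_inv M = X"
proof -
  have XM: "X * M = 1\<^sub>m n" by (rule mat_mult_left_right_inverse[OF M X MX])
  show "invertible_mat M"
    using M X MX XM by (auto simp: invertible_mat_def inverts_mat_def)
  \<comment> \<open>\<open>mat_inverse\<close> returns \<open>None\<close> only on non-units, so
    here \<open>the\<close> is applied to a \<open>Some\<close>.\<close>
  have "M \<in> Units (ring_mat TYPE(complex) n ())"
    using M X MX XM by (auto simp: Units_def ring_mat_def)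
  then obtain Y where Y: "mat_inverse M = Some Y"
    using mat_inverse(1)[OF M, of "()"] by (cases "mat_inverse M") auto
  then have "M * Y = 1\<^sub>m n" "Y \<in> carrier_mat n n" using mat_inverse(2)[OF M] by auto
  then have "Y = X * M * Y" using XM by simp
  also have "\<dots> = X" using M X \<open>M * Y = 1\<^sub>m n\<close> \<open>Y \<in> carrier_mat n n\<close>
    by (simp add: assoc_mult_mat[of _ n n _ n _ n])
  finally show "mat_inv M = X" using Y by simp
qed

lemma mat_inv_props:
  assumes M: "M \<in> carrier_mat n n" and inv: "invertible_mat M"
  shows "mat_inv M \<in> carrier_mat n n" "M * mat_inv M = 1\<^sub>m n" "mat_inv M * M = 1\<^sub>m n"
proof -
  obtain X where MX: "M * X = 1\<^sub>m n" "X * M = 1\<^sub>m (dim_row X)"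
    using M inv by (auto simp: invertible_mat_def inverts_mat_def)
  then have X: "X \<in> carrier_mat n n"
    using M by (metis carrier_matD(2) carrier_matI index_mult_mat(3) index_one_mat(3))
  then show "mat_inv M \<in> carrier_mat n n" "M * mat_inv M = 1\<^sub>m n" "mat_inv M * M = 1\<^sub>m n"
    using MX mat_inv_eqI(2)[OF M X MX(1)] by auto
qed

lemma invertible_mat_cnj:
  assumes M: "M \<in> carrier_mat n n" and inv: "invertible_mat M"
  shows "invertible_mat (mat_cnj M)"
proof (rule mat_inv_eqI(1))
  show "mat_cnj M * mat_cnj (mat_inv M) = 1\<^sub>m n"
    using mat_inv_props[OF assms] mat_cnj_mult[OF M, of "mat_inv M" n] by (simp add: mat_cnj_one)
qed (use M mat_inv_props(1)[OF assms] in auto)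

lemma pow_mat_even_odd:
  fixes M :: "'a :: comm_ring_1 mat"
  assumes M: "M \<in> carrier_mat n n" and sq: "M * M = E"
  shows "M ^\<^sub>m (2 * m) = E ^\<^sub>m m" "M ^\<^sub>m (2 * m + 1) = E ^\<^sub>m m * M" "M ^\<^sub>m (2 * m + 1) = M * E ^\<^sub>m m"
proof -
  have E: "E \<in> carrier_mat n n" using M sq[symmetric] by simp
  note assoc = assoc_mult_mat[of _ n n _ n _ n]
  show *: "M ^\<^sub>m (2 * m) = E ^\<^sub>m m" for m
  proof (induction m)
    case (Suc m)
    have "M ^\<^sub>m (2 * Suc m) = M ^\<^sub>m (2 * m) * (M * M)"
      using M by (simp add: assoc pow_carrier_mat)
    then show ?case using Suc sq by simp
  qed (use M E in auto)
  show "M ^\<^sub>m (2 * m + 1) = E ^\<^sub>m m * M" using * by simp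
  have "E * M = M * E" using M by (simp add: assoc sq[symmetric])
  moreover have "E ^\<^sub>m m * M = M * E ^\<^sub>m m" if "E * M = M * E"
  proof (induction m)
    case (Suc m)
    have "E ^\<^sub>m Suc m * M = E ^\<^sub>m m * M * E"
      using E M that by (simp add: assoc pow_carrier_mat)
    then show ?case using E M Suc by (simp add: assoc pow_carrier_mat)
  qed (use M E in auto)
  ultimately show "M ^\<^sub>m (2 * m + 1) = M * E ^\<^sub>m m" using * by simp
qed

lemma smult_smult_mat: "a \<cdot>\<^sub>m (b \<cdot>\<^sub>m M) = (a * b) \<cdot>\<^sub>m M" for a b :: "'a :: semigroup_mult"
  by (rule eq_matI) (auto simp: mult.assoc)

lemma smult_pow_mat:
  fixes M :: "'a :: comm_semiring_1 mat"
  assumes M: "M \<in> carrier_mat n n"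
  shows "(c \<cdot>\<^sub>m M) ^\<^sub>m k = c ^ k \<cdot>\<^sub>m M ^\<^sub>m k"
proof (induction k)
  case 0
  show ?case using M by (intro eq_matI) auto
next
  case (Suc k)
  have "M ^\<^sub>m k \<in> carrier_mat n n" using M by simp
  then have "(c ^ k \<cdot>\<^sub>m M ^\<^sub>m k) * (c \<cdot>\<^sub>m M) = (c ^ k * c) \<cdot>\<^sub>m (M ^\<^sub>m k * M)"
    using M by (simp add: mult_smult_distrib[of _ n n _ n] mult_smult_assoc_mat[of _ n n _ n]
        smult_smult_mat mult.commute)
  then show ?case using Suc by (simp add: mult.commute)
qed

text \<open>For \<open>M * M = E\<close> the even part of the exponential series of \<open>t M\<close> is a series in \<open>E\<close>, and the odd
  part is \<open>M\<close> times such a series.\<close>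
lemma mat_exp_of_square:
  assumes M: "M \<in> carrier_mat N N" and sq: "M * M = E"
    and C: "C \<in> carrier_mat N N" and S: "S \<in> carrier_mat N N"
    and even: "\<And>i j. i < N \<Longrightarrow> j < N \<Longrightarrow>
      (\<lambda>k. if even k then t ^ k / fact k * (E ^\<^sub>m (k div 2)) $$ (i, j) else 0) sums C $$ (i, j)"
    and odd: "\<And>i j. i < N \<Longrightarrow> j < N \<Longrightarrow>
      (\<lambda>k. if even k then 0 else t ^ k / fact k * (E ^\<^sub>m (k div 2)) $$ (i, j)) sums S $$ (i, j)"
  shows "mat_exp (t \<cdot>\<^sub>m M) = M * S + C"
proof (rule eq_matI)
  have E: "E \<in> carrier_mat N N" using M sq[symmetric] by simp
  fix i j assume "i < dim_row (M * S + C)" "j < dim_col (M * S + C)"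
  then have ij: "i < N" "j < N" using C by auto
  \<comment> \<open>Both series run over the same \<open>k\<close> and vanish on opposite parities,
    so their termwise sum is the exponential series itself, without any reindexing.\<close>
  have "(\<lambda>k. (\<Sum>l<N. M $$ (i, l) * (if even k then 0 else t ^ k / fact k * (E ^\<^sub>m (k div 2)) $$ (l, j)))
      + (if even k then t ^ k / fact k * (E ^\<^sub>m (k div 2)) $$ (i, j) else 0))
      sums ((\<Sum>l<N. M $$ (i, l) * S $$ (l, j)) + C $$ (i, j))"
    using even[OF ij] odd ij by (intro sums_add sums_sum sums_mult) auto
  moreover have "(\<Sum>l<N. M $$ (i, l) * (if even k then 0 else t ^ k / fact k * (E ^\<^sub>m (k div 2)) $$ (l, j)))
      + (if even k then t ^ k / fact k * (E ^\<^sub>m (k div 2)) $$ (i, j) else 0)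
      = ((t \<cdot>\<^sub>m M) ^\<^sub>m k) $$ (i, j) / fact k" for k
  proof -
    have Mk: "M ^\<^sub>m k \<in> carrier_mat N N" using M by simp
    have entry: "((t \<cdot>\<^sub>m M) ^\<^sub>m k) $$ (i, j) = t ^ k * (M ^\<^sub>m k) $$ (i, j)"
      using ij carrier_matD[OF Mk] by (simp add: smult_pow_mat[OF M] del: pow_mat_dim)
    show ?thesis
    proof (cases "even k")
      case True
      then obtain m where "k = 2 * m" by auto
      then show ?thesis unfolding entry using pow_mat_even_odd(1)[OF M sq] by simp
    next
      case False
      then obtain m where k: "k = 2 * m + 1" by (auto elim: oddE)
      have Em: "E ^\<^sub>m m \<in> carrier_mat N N" using E by simp
      have "(M ^\<^sub>m k) $$ (i, j) = (\<Sum>l<N. M $$ (i, l) * (E ^\<^sub>m m) $$ (l, j))"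
        unfolding k pow_mat_even_odd(3)[OF M sq] by (rule index_mult_mat_sum[OF M Em ij])
      then show ?thesis
        unfolding entry using False k
        by (auto simp: sum_distrib_left sum_divide_distrib mult_ac intro!: sum.cong)
    qed
  qed
  ultimately have "(\<lambda>k. ((t \<cdot>\<^sub>m M) ^\<^sub>m k) $$ (i, j) / fact k) sums (M * S + C) $$ (i, j)"
    using ij M S C by (simp add: index_mult_mat_sum[OF M S] del: index_mult_mat(1))
  then show "mat_exp (t \<cdot>\<^sub>m M) $$ (i, j) = (M * S + C) $$ (i, j)"
    using ij M by (simp add: mat_exp_def sums_iff)
qed (use M S C in \<open>auto simp: mat_exp_def\<close>)

lemma mat_fun_carrier: "D \<in> carrier_mat n n \<Longrightarrow> mat_fun f D \<in> carrier_mat n n"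
  by (simp add: mat_fun_def)

section \<open>Powers, inverse and exponential of the block matrix \<open>G\<close>\<close>

theorem mainTheorem7:
  fixes n :: nat and A B D G :: "complex mat"
  assumes A_dim: "A \<in> carrier_mat n n" and B_dim: "B \<in> carrier_mat n n"
    and A_sym: "A = transpose_mat A"
    and B_herm: "B = mat_adjoint B"
    and comm: "B * A = A * mat_cnj B"
    and D_def: "D = A * mat_cnj A - B ^\<^sub>m 2"
    and D_nondeg: "invertible_mat D"
    and G_def: "G = four_block_mat ((- \<i>) \<cdot>\<^sub>m B) A (mat_cnj A) (\<i> \<cdot>\<^sub>m mat_cnj B)"
  shows
    "(\<forall>m::nat.
        G ^\<^sub>m (2 * m) =
          four_block_mat (D ^\<^sub>m m) (0\<^sub>m n n) (0\<^sub>m n n) (mat_cnj D ^\<^sub>m m) \<and>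
        G ^\<^sub>m (2 * m + 1) =
          G * four_block_mat (D ^\<^sub>m m) (0\<^sub>m n n) (0\<^sub>m n n) (mat_cnj D ^\<^sub>m m) \<and>
        G ^\<^sub>m (2 * m + 1) =
          four_block_mat (D ^\<^sub>m m) (0\<^sub>m n n) (0\<^sub>m n n) (mat_cnj D ^\<^sub>m m) * G) \<and>
     invertible_mat G \<and>
     mat_inv G =
       four_block_mat
         ((- \<i>) \<cdot>\<^sub>m (mat_inv D * B)) (mat_inv D * A)
         (mat_inv (mat_cnj D) * mat_cnj A) (\<i> \<cdot>\<^sub>m (mat_inv (mat_cnj D) * mat_cnj B)) \<and>
     mat_inv G =
       four_block_mat
         ((- \<i>) \<cdot>\<^sub>m (B * mat_inv D)) (A * mat_inv (mat_cnj D))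
         (mat_cnj A * mat_inv D) (\<i> \<cdot>\<^sub>m (mat_cnj B * mat_inv (mat_cnj D))) \<and>
     (\<forall>(r::complex \<Rightarrow> complex) (s::complex \<Rightarrow> complex) (t::real).
        (\<forall>z. (r z)\<^sup>2 = z) \<longrightarrow> (\<forall>z. (s z)\<^sup>2 = z) \<longrightarrow>
        mat_exp (complex_of_real t \<cdot>\<^sub>m G) =
          G * four_block_mat
                (mat_fun (\<lambda>z. inverse (r z)) D *
                   mat_fun (\<lambda>z. sinh (r z * complex_of_real t)) D)
                (0\<^sub>m n n)
                (0\<^sub>m n n)
                (mat_fun (\<lambda>z. inverse (s z)) (mat_cnj D) *
                   mat_fun (\<lambda>z. sinh (s z * complex_of_real t)) (mat_cnj D))
          + four_block_mat
                (mat_fun (\<lambda>z. cosh (r z * complex_of_real t)) D)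
                (0\<^sub>m n n)
                (0\<^sub>m n n)
                (mat_fun (\<lambda>z. cosh (s z * complex_of_real t)) (mat_cnj D)))"
proof -
  note assoc = assoc_mult_mat[of _ n n _ n _ n]
  define A' where "A' = mat_cnj A"
  define B' where "B' = mat_cnj B"
  define D' where "D' = mat_cnj D"
  note A = A_dim and B = B_dim
  have A': "A' \<in> carrier_mat n n" and B': "B' \<in> carrier_mat n n"
    using A B by (auto simp: A'_def B'_def)
  have D_eq: "D = A * A' - B * B"
    using B by (simp add: D_def A'_def numeral_2_eq_2)
  have D: "D \<in> carrier_mat n n"
    unfolding D_eq by (rule minus_carrier_mat[OF mult_carrier_mat[OF B B]])
  then have D': "D' \<in> carrier_mat n n" by (simp add: D'_def)
  have cnj_minus: "mat_cnj (X - Y) = mat_cnj X - mat_cnj Y" if "X \<in> carrier_mat n n" "Y \<in> carrier_mat n n" for X Y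
    by (rule eq_matI) (use that in auto)
  have cnj_cnj: "mat_cnj (mat_cnj X) = X" for X
    by (rule eq_matI) auto
  have D'_eq: "D' = A' * A - B' * B'"
    using A B A' B' cnj_cnj[of A]
    by (simp add: D'_def D_eq cnj_minus mat_cnj_mult[of _ n n _ n] A'_def B'_def)
  \<comment> \<open>The conjugated relation, needed for the lower left block of
    \<open>G * G\<close>.\<close>
  have comm': "B' * A' = A' * B"
    using A B arg_cong[OF comm, of mat_cnj] cnj_cnj[of B]
    by (simp add: mat_cnj_mult[of _ n n _ n] A'_def B'_def)
  \<comment> \<open>Symmetry turns the conjugate of \<open>A\<close> into its adjoint, so
    \<open>A * A'\<close> is Hermitian, and with it \<open>D\<close>.\<close>
  have adjA: "mat_adjoint A = A'"
    using A_sym by (simp add: mat_adjoint_eq A'_def)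
  have adjA': "mat_adjoint A' = A"
    using adjA mat_adjoint_adjoint[of A] by simp
  have hermD: "mat_adjoint D = D"
  proof -
    have minus: "mat_adjoint (X - Y) = mat_adjoint X - mat_adjoint Y"
      if "X \<in> carrier_mat n n" "Y \<in> carrier_mat n n" for X Y :: "complex mat"
      by (rule eq_matI) (use that in \<open>auto simp: mat_adjoint_eq\<close>)
    show ?thesis
      using A A' B adjA adjA' B_herm
      by (simp add: D_eq minus mat_adjoint_mult[of _ n n _ n])
  qed
  then have hermD': "mat_adjoint D' = D'"
    by (metis D'_def map_mat_transpose mat_adjoint_eq)
  have invD': "invertible_mat D'"
    using invertible_mat_cnj[OF D D_nondeg] by (simp add: D'_def)
  define blk where "blk = (\<lambda>X Y. four_block_mat X (0\<^sub>m n n) (0\<^sub>m n n) Y :: complex mat)"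
  have blk: "blk X Y \<in> carrier_mat (n + n) (n + n)" if "X \<in> carrier_mat n n" "Y \<in> carrier_mat n n" for X Y
    using that by (simp add: blk_def)
  have G_eq: "G = four_block_mat ((- \<i>) \<cdot>\<^sub>m B) A A' (\<i> \<cdot>\<^sub>m B')"
    by (simp add: G_def A'_def B'_def)
  have G: "G \<in> carrier_mat (n + n) (n + n)"
    using B B' by (simp add: G_eq)
  have sB: "(- \<i>) \<cdot>\<^sub>m B \<in> carrier_mat n n" and sB': "\<i> \<cdot>\<^sub>m B' \<in> carrier_mat n n"
    using B B' by auto
  note smult = mult_smult_distrib[of _ n n _ n] mult_smult_assoc_mat[of _ n n _ n] smult_smult_mat
  have GG: "G * G = blk D D'"
  proof -
    have "((- \<i>) \<cdot>\<^sub>m B) * ((- \<i>) \<cdot>\<^sub>m B) + A * A' = D"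
      unfolding D_eq using A A' B
      by (intro eq_matI) (auto simp: smult simp del: index_mult_mat(1))
    moreover have "((- \<i>) \<cdot>\<^sub>m B) * A + A * (\<i> \<cdot>\<^sub>m B') = 0\<^sub>m n n"
      using A B B' comm
      by (intro eq_matI) (auto simp: smult B'_def[symmetric] simp del: index_mult_mat(1))
    moreover have "A' * ((- \<i>) \<cdot>\<^sub>m B) + (\<i> \<cdot>\<^sub>m B') * A' = 0\<^sub>m n n"
      using A' B B' comm'
      by (intro eq_matI) (auto simp: smult simp del: index_mult_mat(1))
    moreover have "A' * A + (\<i> \<cdot>\<^sub>m B') * (\<i> \<cdot>\<^sub>m B') = D'"
      unfolding D'_eq using A A' B'
      by (intro eq_matI) (auto simp: smult simp del: index_mult_mat(1))
    ultimately show ?thesis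
      unfolding G_eq mult_four_block_mat[OF sB A A' sB' sB A A' sB'] blk_def by simp
  qed
  have pow_blk: "blk D D' ^\<^sub>m m = blk (D ^\<^sub>m m) (D' ^\<^sub>m m)" for m
    unfolding blk_def by (rule pow_four_block_mat[OF D D'])
  note powers = pow_mat_even_odd[OF G GG, unfolded pow_blk]
  define I where "I = mat_inv D"
  define I' where "I' = mat_inv D'"
  note inv = mat_inv_props[OF D D_nondeg, folded I_def] mat_inv_props[OF D' invD', folded I'_def]
  note z = zero_carrier_mat[of n n]
  have blkI: "blk I I' \<in> carrier_mat (n + n) (n + n)" using blk inv by blast
  have DI: "blk D D' * blk I I' = 1\<^sub>m (n + n)"
    unfolding blk_def mult_four_block_mat[OF D z z D' inv(1) z z inv(4)]
    using inv D D' by simp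
  have ID: "blk I I' * blk D D' = 1\<^sub>m (n + n)"
    by (rule mat_mult_left_right_inverse[OF blk[OF D D'] blkI DI])
  \<comment> \<open>Since \<open>G * G\<close> is inverted by \<open>blk I I'\<close>, multiplying
    that inverse by \<open>G\<close> on either side inverts \<open>G\<close>. The two products are
    the two displayed forms of the inverse.\<close>
  have right: "G * (G * blk I I') = 1\<^sub>m (n + n)"
    using G blkI DI by (simp add: assoc_mult_mat[symmetric] GG)
  have left: "(blk I I' * G) * G = 1\<^sub>m (n + n)"
    using assoc_mult_mat[OF blkI G G] ID by (simp add: GG)
  have GI: "G * blk I I' \<in> carrier_mat (n + n) (n + n)" and IG: "blk I I' * G \<in> carrier_mat (n + n) (n + n)"
    using G blkI by auto
  note inv_right = mat_inv_eqI[OF G GI right]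
  note inv_left = mat_inv_eqI(2)[OF G IG mat_mult_left_right_inverse[OF IG G left]]
  have block_right: "G * blk I I' = four_block_mat ((- \<i>) \<cdot>\<^sub>m (B * I)) (A * I') (A' * I) (\<i> \<cdot>\<^sub>m (B' * I'))"
    unfolding G_eq blk_def mult_four_block_mat[OF sB A A' sB' inv(1) z z inv(4)]
    using A A' B B' inv by (simp add: smult)
  have block_left: "blk I I' * G = four_block_mat ((- \<i>) \<cdot>\<^sub>m (I * B)) (I * A) (I' * A') (\<i> \<cdot>\<^sub>m (I' * B'))"
    unfolding G_eq blk_def mult_four_block_mat[OF inv(1) z z inv(4) sB A A' sB']
    using A A' B B' inv by (simp add: smult)
  have exp: "mat_exp (complex_of_real t \<cdot>\<^sub>m G) =
      G * blk (mat_fun (\<lambda>z. inverse (r z)) D * mat_fun (\<lambda>z. sinh (r z * complex_of_real t)) D)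
            (mat_fun (\<lambda>z. inverse (s z)) D' * mat_fun (\<lambda>z. sinh (s z * complex_of_real t)) D')
      + blk (mat_fun (\<lambda>z. cosh (r z * complex_of_real t)) D) (mat_fun (\<lambda>z. cosh (s z * complex_of_real t)) D')"
    if r: "\<And>z. (r z)\<^sup>2 = z" and s: "\<And>z. (s z)\<^sup>2 = z" for r s :: "complex \<Rightarrow> complex" and t :: real
  proof -
    \<comment> \<open>The two diagonal blocks get independent eigenbases, just as they get
      independent roots \<open>r\<close> and \<open>s\<close>.\<close>
    obtain P Q d where "hermitian_eigenbasis n D P Q d"
      using hermitian_eigenbasis_exists[OF D hermD] .
    then interpret D: hermitian_eigenbasis n D P Q d .
    obtain P' Q' d' where "hermitian_eigenbasis n D' P' Q' d'"
      using hermitian_eigenbasis_exists[OF D' hermD'] .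
    then interpret D': hermitian_eigenbasis n D' P' Q' d' .
    have blk_idx: "blk X Y $$ (i, j) =
        (if i < n then if j < n then X $$ (i, j) else 0 else if j < n then 0 else Y $$ (i - n, j - n))"
      if "X \<in> carrier_mat n n" "Y \<in> carrier_mat n n" "i < n + n" "j < n + n" for X Y i j
      using that by (simp add: blk_def)
    note fun_carrier = mat_fun_carrier[OF D] mat_fun_carrier[OF D']
      mult_carrier_mat[OF mat_fun_carrier[OF D] mat_fun_carrier[OF D]]
      mult_carrier_mat[OF mat_fun_carrier[OF D'] mat_fun_carrier[OF D']]
    note idx = blk_idx[OF fun_carrier(1,2)] blk_idx[OF fun_carrier(3,4)]
      blk_idx[OF pow_carrier_mat[OF D] pow_carrier_mat[OF D']]
    show ?thesis
    proof (rule mat_exp_of_square[OF G GG])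
      \<comment> \<open>The series are identically zero in the off-diagonal blocks. In the lower
        diagonal block the scalar series are used at indices shifted by \<open>n\<close>.\<close>
      fix i j assume ij: "i < n + n" "j < n + n"
      show "(\<lambda>k. if even k then complex_of_real t ^ k / fact k * (blk D D' ^\<^sub>m (k div 2)) $$ (i, j) else 0) sums
        blk (mat_fun (\<lambda>z. cosh (r z * complex_of_real t)) D) (mat_fun (\<lambda>z. cosh (s z * complex_of_real t)) D') $$ (i, j)"
        using ij D.cosh_series[OF r, of i j t] D'.cosh_series[OF s, of "i - n" "j - n" t]
        by (auto simp: pow_blk idx cong: if_cong)
      show "(\<lambda>k. if even k then 0 else complex_of_real t ^ k / fact k * (blk D D' ^\<^sub>m (k div 2)) $$ (i, j)) sums
        blk (mat_fun (\<lambda>z. inverse (r z)) D * mat_fun (\<lambda>z. sinh (r z * complex_of_real t)) D)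
          (mat_fun (\<lambda>z. inverse (s z)) D' * mat_fun (\<lambda>z. sinh (s z * complex_of_real t)) D') $$ (i, j)"
        using ij D.sinh_series[OF r D_nondeg, of i j t] D'.sinh_series[OF s invD', of "i - n" "j - n" t]
        by (auto simp: pow_blk idx simp del: index_mult_mat(1) cong: if_cong)
    qed (intro blk fun_carrier)+
  qed
  show ?thesis
    unfolding D'_def[symmetric] A'_def[symmetric] B'_def[symmetric] I_def[symmetric] I'_def[symmetric]
      fun_cong[OF fun_cong[OF blk_def], symmetric]
      block_left[symmetric] block_right[symmetric]
    using powers inv_right inv_left exp by simp
qed

end
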